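(* Let $k$ be a positive integer, and let $n$ and $r$ be integers with $n<3k$ and $r\ge 2(k-1)$ such that there exists at least one $r$-regular graph on $n$ vertices with chromatic number $k$. Then $d(n,r,\chi=k)=k-1$.
   Context: All graphs are finite and simple. For a graph $G$, $\chi(G)$ denotes its chromatic number. A set $S$ of vertices of $G$ together with an assignment of colors to the vertices of $S$ is a defining set of the vertex coloring of $G$ if this partial coloring extends in exactly one way to a proper coloring of all vertices of $G$ with $\chi(G)$ colors. The defining number $d(G,\chi)$ is the minimum cardinality of a defining set of $G$. For integers $n,r,k$, $d(n,r,\chi=k)$ denotes the minimum of $d(G,\chi)$ over all $r$-regular graphs $G$ on $n$ vertices with $\chi(G)=k$. *)

theory Defs
  imports "Graph_Theory.Pair_Digraph" "HOL-Library.FuncSet"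
begin

text \<open>
  A finite simple graph is a \<open>pair_graph\<close>: finite vertex set, symmetric irreflexive arc relation.
  Each undirected edge is represented by both of its arcs, so \<open>out_degree\<close> is the vertex degree.
\<close>

definition regular :: "'a pair_pre_digraph \<Rightarrow> nat \<Rightarrow> bool" where
  "regular G r \<longleftrightarrow> (\<forall>v\<in>pverts G. out_degree (with_proj G) v = r)"

text \<open>
  Colorings use the fixed color set \<open>{..<k}\<close>; they are extensional functions, so that two
  colorings are equal iff they agree on all vertices.
\<close>

definition proper_colorings :: "'a pair_pre_digraph \<Rightarrow> nat \<Rightarrow> ('a \<Rightarrow> nat) set" where
  "proper_colorings G k =
     {c \<in> pverts G \<rightarrow>\<^sub>E {..<k}. \<forall>(u, v)\<in>parcs G. c u \<noteq> c v}"

definition chromatic_number :: "'a pair_pre_digraph \<Rightarrow> nat" where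
  "chromatic_number G = (LEAST k. proper_colorings G k \<noteq> {})"

definition defining_set :: "'a pair_pre_digraph \<Rightarrow> 'a set \<Rightarrow> ('a \<Rightarrow> nat) \<Rightarrow> bool" where
  "defining_set G S f \<longleftrightarrow>
     S \<subseteq> pverts G \<and> f \<in> S \<rightarrow> {..<chromatic_number G} \<and>
     (\<exists>!c. c \<in> proper_colorings G (chromatic_number G) \<and> (\<forall>v\<in>S. c v = f v))"

definition defining_number :: "'a pair_pre_digraph \<Rightarrow> nat" where
  "defining_number G = (LEAST m. \<exists>S f. defining_set G S f \<and> card S = m)"

text \<open>Every finite graph is isomorphic to one whose vertices are natural numbers.\<close>

definition regular_graphs :: "nat \<Rightarrow> nat \<Rightarrow> nat \<Rightarrow> nat pair_pre_digraph set" where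
  "regular_graphs n r k =
     {G. pair_graph G \<and> card (pverts G) = n \<and> regular G r \<and> chromatic_number G = k}"

definition min_defining_number :: "nat \<Rightarrow> nat \<Rightarrow> nat \<Rightarrow> nat" where
  "min_defining_number n r k = (LEAST m. \<exists>G\<in>regular_graphs n r k. defining_number G = m)"

end

theory Submission
  imports Defs
begin

text \<open>
  A set missing two colors is never defining, because these two colors can be swapped; hence
  \<open>k - 1\<close> is a lower bound. For equality it suffices to find one graph of the given parameters that
  contains a \<open>k\<close>-clique and has an order of its vertices, beginning with \<open>k - 1\<close> precolored ones,
  in which every later vertex already sees all colors but its own.

  Such a graph is described by its complement \<open>H\<close>, which is \<open>(n - r - 1)\<close>-regular. Put
  \<open>t = n - 2k\<close>, \<open>p = 3k - n\<close> and \<open>e = n - r - 3\<close>; the color classes are to be \<open>t\<close> triples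
  \<open>{A\<^sub>i, B\<^sub>i, C\<^sub>i}\<close> and \<open>p\<close> pairs \<open>{X\<^sub>q, Y\<^sub>q}\<close>, and \<open>r \<ge> 2(k - 1)\<close> says \<open>e < t\<close>. On an \<open>e\<close>-regular circulant graph
  on the indices of the triples, put \<open>A\<^sub>iB\<^sub>j\<close>, \<open>B\<^sub>iC\<^sub>j\<close>, \<open>C\<^sub>iA\<^sub>j\<close> into \<open>H\<close> for every edge \<open>i < j\<close>;
  put \<open>X\<^sub>qY\<^sub>q\<^sub>'\<close> into \<open>H\<close> for \<open>q < q' \<le> q + e + 1\<close>. The pairs at the two ends of this chain lack
  degree, which is supplied by deleting edges \<open>C\<^sub>iA\<^sub>j\<close>, \<open>C\<^sub>iB\<^sub>j\<close> and joining \<open>C\<^sub>i\<close> to some \<open>X\<close> and the other end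
  to some \<open>Y\<close>. The vertices are forced in the order \<open>A, X\<close>; \<open>B\<^sub>0, B\<^sub>1, \<dots>\<close>; \<open>Y\<^sub>0, Y\<^sub>1, \<dots>\<close>; \<open>C\<close>.

  The supply of edges is insufficient only for \<open>e \<le> 0\<close> and for \<open>e = 1\<close>, \<open>t = 2\<close>, \<open>p \<ge> 2\<close>. Here \<open>H\<close> is a
  disjoint union of complete graphs and a bipartite circulant graph, except for a single graph
  on 10 vertices; and for \<open>e = 0\<close>, \<open>p = 1\<close> there is no graph with the given parameters at all.
\<close>

subsection \<open>Defining sets and forcing orders\<close>

lemma out_degree_with_proj:
  "out_degree (with_proj G) v = card {u. (v, u) \<in> parcs G}"
proof -
  have "out_arcs (with_proj G) v = Pair v ` {u. (v, u) \<in> parcs G}"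
    by (auto simp: out_arcs_def)
  then show ?thesis
    by (simp add: out_degree_def card_image inj_on_def)
qed

lemma proper_coloringsI:
  assumes "\<And>v. v \<in> pverts G \<Longrightarrow> c v < k"
    and "\<And>u v. (u, v) \<in> parcs G \<Longrightarrow> u \<in> pverts G \<and> v \<in> pverts G \<and> c u \<noteq> c v"
  shows "restrict c (pverts G) \<in> proper_colorings G k"
  using assms unfolding proper_colorings_def by fastforce

lemma proper_colorings_lt: "c \<in> proper_colorings G k \<Longrightarrow> v \<in> pverts G \<Longrightarrow> c v < k"
  by (auto simp: proper_colorings_def)

lemma proper_colorings_neq: "c \<in> proper_colorings G k \<Longrightarrow> (u, v) \<in> parcs G \<Longrightarrow> c u \<noteq> c v"
  by (auto simp: proper_colorings_def)

text \<open>Since there are no loops, an injective coloring is proper, so the \<open>LEAST\<close>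
  in \<open>chromatic_number\<close> is taken over a nonempty set and is attained.\<close>

lemma proper_colorings_chromatic_number:
  assumes "pair_graph G"
  shows "proper_colorings G (chromatic_number G) \<noteq> {}"
proof -
  interpret pair_graph G by fact
  obtain h where h: "bij_betw h (pverts G) {0..<card (pverts G)}"
    using ex_bij_betw_finite_nat[OF pair_finite_verts] by blast
  have "restrict h (pverts G) \<in> proper_colorings G (card (pverts G))"
  proof (rule proper_coloringsI)
    show "h v < card (pverts G)" if "v \<in> pverts G" for v
      using h that bij_betwE by fastforce
    show "u \<in> pverts G \<and> v \<in> pverts G \<and> h u \<noteq> h v" if "(u, v) \<in> parcs G" for u v
      using that in_arcsD1 in_arcsD2 no_loops' h by (metis bij_betw_inv_into_left)
  qed
  then show ?thesis
    unfolding chromatic_number_def by (metis (mono_tags, lifting) LeastI empty_iff)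
qed

lemma chromatic_number_le: "c \<in> proper_colorings G m \<Longrightarrow> chromatic_number G \<le> m"
  unfolding chromatic_number_def by (rule Least_le) auto

lemma proper_colorings_surj:
  assumes "pair_graph G" and c: "c \<in> proper_colorings G (chromatic_number G)"
    and j: "j < chromatic_number G"
  shows "\<exists>v\<in>pverts G. c v = j"
proof (rule ccontr)
  assume no: "\<not> ?thesis"
  interpret pair_graph G by fact
  let ?k = "chromatic_number G"
  let ?c = "\<lambda>v. if c v = ?k - 1 then j else c v"
  have "restrict ?c (pverts G) \<in> proper_colorings G (?k - 1)"
  proof (rule proper_coloringsI)
    show "?c v < ?k - 1" if "v \<in> pverts G" for v
      using proper_colorings_lt[OF c that] no that j by (cases "j = ?k - 1") auto
    show "u \<in> pverts G \<and> v \<in> pverts G \<and> ?c u \<noteq> ?c v" if uv: "(u, v) \<in> parcs G" for u v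
      using in_arcsD1[OF uv] in_arcsD2[OF uv] proper_colorings_neq[OF c uv] no by auto
  qed
  then show False using chromatic_number_le j by fastforce
qed

section \<open>The lower bound for defining numbers\<close>

lemma defining_number_attained:
  assumes "pair_graph G"
  shows "\<exists>S f. defining_set G S f \<and> card S = defining_number G"
proof -
  obtain c where c: "c \<in> proper_colorings G (chromatic_number G)"
    using proper_colorings_chromatic_number[OF assms] by blast
  have "defining_set G (pverts G) c"
    unfolding defining_set_def
  proof (intro conjI ex1I[of _ c])
    show "c \<in> pverts G \<rightarrow> {..<chromatic_number G}"
      using proper_colorings_lt[OF c] by auto
    show "d = c" if "d \<in> proper_colorings G (chromatic_number G) \<and> (\<forall>v\<in>pverts G. d v = c v)" for d
      using that c by (auto simp: proper_colorings_def intro: PiE_ext)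
  qed (use c in auto)
  then have "\<exists>m S f. defining_set G S f \<and> card S = m" by blast
  then show ?thesis unfolding defining_number_def by (rule LeastI_ex)
qed

lemma defining_number_le: "defining_set G S f \<Longrightarrow> defining_number G \<le> card S"
  unfolding defining_number_def by (rule Least_le) auto

text \<open>If two colors are absent from \<open>S\<close>, swapping them gives another extension.
  It really differs from the first one because minimality of the number of colors puts every color
  on some vertex.\<close>

lemma defining_set_card_ge:
  assumes G: "pair_graph G" and S: "defining_set G S f"
  shows "chromatic_number G - 1 \<le> card S"
proof (rule ccontr)
  let ?k = "chromatic_number G"
  assume small: "\<not> ?k - 1 \<le> card S"
  interpret pair_graph G by fact
  have SV: "S \<subseteq> pverts G" using S by (simp add: defining_set_def)
  then have finS: "finite S" using pair_finite_verts finite_subset by blast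
  obtain c where c: "c \<in> proper_colorings G ?k" "\<forall>v\<in>S. c v = f v"
    and uniq: "\<And>d. d \<in> proper_colorings G ?k \<Longrightarrow> (\<forall>v\<in>S. d v = f v) \<Longrightarrow> d = c"
    using S unfolding defining_set_def by blast
  have "card (c ` S) \<le> card S" using finS by (rule card_image_le)
  then have "2 \<le> card ({..<?k} - c ` S)"
    using diff_card_le_card_Diff[of "c ` S" "{..<?k}"] finS small by auto
  then obtain T where "T \<subseteq> {..<?k} - c ` S" "card T = 2"
    by (rule obtain_subset_with_card_n)
  then obtain a b where ab: "a \<in> {..<?k} - c ` S" "b \<in> {..<?k} - c ` S" "a \<noteq> b"
    by (auto simp: card_2_iff)
  let ?d = "\<lambda>v. if c v = a then b else if c v = b then a else c v"
  have "restrict ?d (pverts G) \<in> proper_colorings G ?k"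
  proof (rule proper_coloringsI)
    show "?d v < ?k" if "v \<in> pverts G" for v
      using proper_colorings_lt[OF c(1) that] ab by auto
    show "u \<in> pverts G \<and> v \<in> pverts G \<and> ?d u \<noteq> ?d v" if uv: "(u, v) \<in> parcs G" for u v
      using in_arcsD1[OF uv] in_arcsD2[OF uv] proper_colorings_neq[OF c(1) uv] ab by auto
  qed
  moreover have "\<forall>v\<in>S. restrict ?d (pverts G) v = f v"
    using c(2) ab SV by force
  ultimately have eq: "restrict ?d (pverts G) = c" by (rule uniq)
  obtain v where v: "v \<in> pverts G" "c v = a"
    using proper_colorings_surj[OF G c(1)] ab by blast
  have "restrict ?d (pverts G) v = b" using v by simp
  then show False using eq v ab by simp
qed

lemma defining_number_ge:
  "pair_graph G \<Longrightarrow> chromatic_number G - 1 \<le> defining_number G"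
  using defining_number_attained defining_set_card_ge by metis

text \<open>The lower bound holds for all graphs of the family, so a single graph that meets it
  determines the minimum.\<close>

lemma min_defining_number_eqI:
  assumes "G \<in> regular_graphs n r k" and "defining_number G \<le> k - 1"
  shows "min_defining_number n r k = k - 1"
  unfolding min_defining_number_def
proof (rule Least_equality)
  have "defining_number G = k - 1"
    using assms defining_number_ge[of G] by (auto simp: regular_graphs_def)
  then show "\<exists>G\<in>regular_graphs n r k. defining_number G = k - 1"
    using assms by blast
  show "k - 1 \<le> m" if "\<exists>G\<in>regular_graphs n r k. defining_number G = m" for m
    using that defining_number_ge by (fastforce simp: regular_graphs_def)
qed

text \<open>
  The relation \<open>H\<close> is non-adjacency of distinct vertices. Coloring the vertices in the order of
  \<open>rk\<close>, every vertex outside \<open>S\<close> already sees all colors but its own.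
\<close>

lemma forced_coloring_unique:
  fixes rk :: "'a \<Rightarrow> nat"
  assumes "v \<in> V"
    and force: "\<And>v j. \<lbrakk>v \<in> V; v \<notin> S; j < k; j \<noteq> col v\<rbrakk> \<Longrightarrow>
      \<exists>u\<in>V. rk u < rk v \<and> col u = j \<and> \<not> H u v"
    and nonadj: "\<And>u v. \<lbrakk>u \<in> V; v \<in> V; u \<noteq> v; \<not> H u v\<rbrakk> \<Longrightarrow> c u \<noteq> (c v :: nat)"
    and lt: "\<And>v. v \<in> V \<Longrightarrow> c v < k"
    and agree: "\<And>v. v \<in> S \<Longrightarrow> c v = col v"
  shows "c v = col v"
  using assms(1)
proof (induction "rk v" arbitrary: v rule: less_induct)
  case less
  show ?case
  proof (rule ccontr)
    assume ne: "c v \<noteq> col v"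
    then have "v \<notin> S" using agree by blast
    then obtain u where u: "u \<in> V" "rk u < rk v" "col u = c v" "\<not> H u v"
      using force[OF less.prems _ lt[OF less.prems] ne] by blast
    then have "c u = c v" using less.hyps by simp
    moreover have "u \<noteq> v" using u by auto
    ultimately show False using nonadj u less.prems by blast
  qed
qed

text \<open>Carries a construction, given by its complement \<open>H\<close> on any vertex type,
  over to graphs on naturals. The coloring \<open>col\<close> bounds the chromatic number from
  above, the clique \<open>I\<close> bounds it from below, and the order \<open>rk\<close> makes
  \<open>S\<close> defining. The complement has degree \<open>d\<close>, whence the vertex count
  \<open>r + d + 1\<close>.\<close>

lemma forcing_complement_realization:
  fixes V :: "'a set" and H :: "'a \<Rightarrow> 'a \<Rightarrow> bool" and col rk :: "'a \<Rightarrow> nat"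
  assumes finV: "finite V" and cardV: "card V = r + d + 1"
    and sym: "\<And>u v. \<lbrakk>u \<in> V; v \<in> V; H u v\<rbrakk> \<Longrightarrow> H v u"
    and irr: "\<And>v. v \<in> V \<Longrightarrow> \<not> H v v"
    and deg: "\<And>v. v \<in> V \<Longrightarrow> card {u\<in>V. H v u} = d"
    and col: "\<And>v. v \<in> V \<Longrightarrow> col v < k"
    and same: "\<And>u v. \<lbrakk>u \<in> V; v \<in> V; u \<noteq> v; col u = col v\<rbrakk> \<Longrightarrow> H u v"
    and I: "I \<subseteq> V" "card I = k" "\<And>u v. \<lbrakk>u \<in> I; v \<in> I; u \<noteq> v\<rbrakk> \<Longrightarrow> \<not> H u v"
    and S: "S \<subseteq> V" "card S \<le> k - 1"
    and force: "\<And>v j. \<lbrakk>v \<in> V; v \<notin> S; j < k; j \<noteq> col v\<rbrakk> \<Longrightarrow>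
      \<exists>u\<in>V. rk u < rk v \<and> col u = j \<and> \<not> H u v"
  shows "\<exists>G\<in>regular_graphs (card V) r k. defining_number G \<le> k - 1"
proof -
  let ?n = "card V"
  obtain h where h: "bij_betw h {0..<?n} V"
    using ex_bij_betw_nat_finite[OF finV] by blast
  define g where "g = inv_into {0..<?n} h"
  have hV: "h i \<in> V" if "i < ?n" for i using h that bij_betwE by fastforce
  have gV: "g v < ?n" "h (g v) = v" if "v \<in> V" for v
    using bij_betw_inv_into_right[OF h that] bij_betw_inv_into[OF h] that
    unfolding g_def by (auto dest: bij_betwE)
  have gh: "g (h i) = i" if "i < ?n" for i
    using bij_betw_inv_into_left[OF h] that unfolding g_def by auto
  define G where "G = \<lparr>pverts = {0..<?n},
    parcs = {(i, j). i < ?n \<and> j < ?n \<and> i \<noteq> j \<and> \<not> H (h i) (h j)}\<rparr>"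
  have vG: "pverts G = {0..<?n}" by (simp add: G_def)
  have aG: "(i, j) \<in> parcs G \<longleftrightarrow> i < ?n \<and> j < ?n \<and> i \<noteq> j \<and> \<not> H (h i) (h j)" for i j
    by (simp add: G_def)
  have "parcs G \<subseteq> {0..<?n} \<times> {0..<?n}" using aG by auto
  then have "finite (parcs G)" by (rule finite_subset) simp
  moreover have "symmetric (with_proj G)"
    unfolding symmetric_def with_proj_simps sym_def using aG sym hV by blast
  ultimately have PG: "pair_graph G"
    by unfold_locales (auto simp: vG aG)
  have "regular G r"
    unfolding regular_def out_degree_with_proj
  proof
    fix i assume "i \<in> pverts G"
    then have i: "i < ?n" by (simp add: vG)
    have "{j. (i, j) \<in> parcs G} = g ` (V - insert (h i) {u\<in>V. H (h i) u})"
    proof (intro equalityI subsetI)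
      fix j assume "j \<in> {j. (i, j) \<in> parcs G}"
      then have "j < ?n" "i \<noteq> j" "\<not> H (h i) (h j)" using aG by auto
      then show "j \<in> g ` (V - insert (h i) {u\<in>V. H (h i) u})"
        using gh hV i by (intro image_eqI[of _ _ "h j"]) (auto, metis gh)
    next
      fix j assume "j \<in> g ` (V - insert (h i) {u\<in>V. H (h i) u})"
      then show "j \<in> {j. (i, j) \<in> parcs G}" using aG gV i by auto
    qed
    moreover have "inj_on g V" using gV by (metis inj_onI)
    ultimately have "card {j. (i, j) \<in> parcs G} = card (V - insert (h i) {u\<in>V. H (h i) u})"
      by (metis Diff_subset card_image inj_on_subset)
    also have "\<dots> = card V - card (insert (h i) {u\<in>V. H (h i) u})"
      using finV hV[OF i] by (intro card_Diff_subset) auto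
    also have "\<dots> = r" using finV deg[OF hV[OF i]] irr[OF hV[OF i]] cardV by simp
    finally show "card {j. (i, j) \<in> parcs G} = r" .
  qed
  have colG: "restrict (col \<circ> h) (pverts G) \<in> proper_colorings G k"
  proof (rule proper_coloringsI)
    show "(col \<circ> h) i < k" if "i \<in> pverts G" for i using col hV that by (simp add: vG)
    show "i \<in> pverts G \<and> j \<in> pverts G \<and> (col \<circ> h) i \<noteq> (col \<circ> h) j" if "(i, j) \<in> parcs G" for i j
    proof -
      have "i < ?n" "j < ?n" "i \<noteq> j" "\<not> H (h i) (h j)" using that aG by auto
      moreover then have "h i \<noteq> h j" using gh by metis
      ultimately show ?thesis using same[of "h i" "h j"] hV by (auto simp: vG)
    qed
  qed
  have chi: "chromatic_number G = k"
  proof (rule antisym)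
    show "chromatic_number G \<le> k" using chromatic_number_le[OF colG] .
    obtain c where c: "c \<in> proper_colorings G (chromatic_number G)"
      using proper_colorings_chromatic_number[OF PG] by blast
    have "inj_on (c \<circ> g) I"
    proof (rule inj_onI, rule ccontr)
      fix u v assume uv: "u \<in> I" "v \<in> I" "(c \<circ> g) u = (c \<circ> g) v" "u \<noteq> v"
      then have "(g u, g v) \<in> parcs G" using aG gV I by (metis subsetD)
      then show False using proper_colorings_neq[OF c] uv by auto
    qed
    moreover have "(c \<circ> g) ` I \<subseteq> {..<chromatic_number G}"
      using proper_colorings_lt[OF c] gV I by (auto simp: vG)
    ultimately have "card I \<le> card {..<chromatic_number G}"
      by (metis card_inj_on_le finite_lessThan)
    then show "k \<le> chromatic_number G" using I by simp
  qed
  have "defining_set G (g ` S) (col \<circ> h)"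
    unfolding defining_set_def chi
  proof (intro conjI ex1I[of _ "restrict (col \<circ> h) (pverts G)"])
    show "g ` S \<subseteq> pverts G" using gV S by (auto simp: vG)
    show "col \<circ> h \<in> g ` S \<rightarrow> {..<k}" using gV S col by auto
    show "restrict (col \<circ> h) (pverts G) \<in> proper_colorings G k" by (rule colG)
    show "\<forall>v\<in>g ` S. restrict (col \<circ> h) (pverts G) v = (col \<circ> h) v"
      using gV S by (auto simp: vG)
    fix c assume c: "c \<in> proper_colorings G k \<and> (\<forall>v\<in>g ` S. c v = (col \<circ> h) v)"
    have "(c \<circ> g) v = col v" if "v \<in> V" for v
      using that
    proof (rule forced_coloring_unique[where V = V and S = S and H = H and rk = rk and k = k, OF _ force])
      show "(c \<circ> g) u \<noteq> (c \<circ> g) v" if "u \<in> V" "v \<in> V" "u \<noteq> v" "\<not> H u v" for u v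
      proof -
        have "(g u, g v) \<in> parcs G" using aG gV that by metis
        then show ?thesis using c proper_colorings_neq by fastforce
      qed
      show "(c \<circ> g) v < k" if "v \<in> V" for v
        using c proper_colorings_lt[of c G k "g v"] gV that by (auto simp: vG)
      show "(c \<circ> g) v = col v" if "v \<in> S" for v
        using c gV S that by auto
    qed auto
    then have "c i = (col \<circ> h) i" if "i < ?n" for i using hV[OF that] gh[OF that] by fastforce
    moreover have "c i = undefined" if "\<not> i < ?n" for i
      using c that by (auto simp: vG proper_colorings_def PiE_def extensional_def)
    ultimately show "c = restrict (col \<circ> h) (pverts G)"
      by (auto simp: vG restrict_def)
  qed
  then have "defining_number G \<le> card (g ` S)" by (rule defining_number_le)
  also have "\<dots> \<le> k - 1" using S finV finite_subset card_image_le le_trans by metis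
  finally show ?thesis
    using PG \<open>regular G r\<close> chi by (auto simp: regular_graphs_def vG)
qed

subsection \<open>Cliques and bipartite circulants\<close>

text \<open>
  The complement consists of \<open>q\<close> cliques and a \<open>d\<close>-regular bipartite circulant. Precoloring one
  vertex of each of its color pairs, on the left for the first \<open>d - 1\<close> pairs and on the right for the others, leaves
  two bipartite graphs that are triangular and so have a unique perfect matching.
\<close>

datatype cc_vertex = Clq nat nat | Lft nat | Rgt nat

lemma cliques_plus_circulant:
  fixes q m d r :: nat
  assumes q: "q > 0" and m: "m = 0 \<or> 0 < d \<and> d \<le> m \<and> 2 * d \<le> m + 2"
    and r: "q * (d + 1) + 2 * m = r + d + 1"
  shows "\<exists>G\<in>regular_graphs (q * (d + 1) + 2 * m) r (q + m). defining_number G \<le> q + m - 1"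
proof -
  define V where "V = case_prod Clq ` ({..<q} \<times> {..d}) \<union> Lft ` {..<m} \<union> Rgt ` {..<m}"
  \<comment> \<open>For \<open>i, j < m\<close>, this says that \<open>j\<close> is one of
    \<open>i, ..., i + d - 1\<close> modulo \<open>m\<close>; the second disjunct is the
    wrap-around.\<close>
  define A where "A i j \<longleftrightarrow> i \<le> j \<and> j < i + d \<or> j + m < i + d" for i j
  define H where "H u v = (case (u, v) of
      (Clq i x, Clq j y) \<Rightarrow> i = j \<and> x \<noteq> y
    | (Lft i, Rgt j) \<Rightarrow> A i j
    | (Rgt j, Lft i) \<Rightarrow> A i j
    | _ \<Rightarrow> False)" for u v
  define col where "col v = (case v of Clq i x \<Rightarrow> i | Lft i \<Rightarrow> q + i | Rgt i \<Rightarrow> q + i)" for v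
  \<comment> \<open>Within \<open>V\<close>, rank 0 is exactly \<open>S\<close>. The one clique
    without a precolored vertex gets its representative at rank 1. Then free left vertices follow by
    decreasing index and free right vertices by increasing index.\<close>
  define rk where "rk v = (case v of
      Clq i x \<Rightarrow> if x = 0 then if i < q - 1 then 0 else 1 else 2
    | Lft i \<Rightarrow> if i < d - 1 then 0 else 2 + (m - i)
    | Rgt i \<Rightarrow> if i < d - 1 then 2 + i else 0)" for v
  define I where "I = (\<lambda>i. Clq i 0) ` {..<q} \<union> Lft ` {..<m}"
  define S where "S = (\<lambda>i. Clq i 0) ` {..<q - 1} \<union> Lft ` {..<min (d - 1) m} \<union> Rgt ` {d - 1..<m}"
  have V_iff [simp]: "Clq i x \<in> V \<longleftrightarrow> i < q \<and> x \<le> d" "Lft i \<in> V \<longleftrightarrow> i < m" "Rgt i \<in> V \<longleftrightarrow> i < m"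
    for i x by (auto simp: V_def)
  have S_iff [simp]: "Clq i x \<in> S \<longleftrightarrow> i < q - 1 \<and> x = 0" "Lft i \<in> S \<longleftrightarrow> i < m \<and> i < d - 1"
      "Rgt i \<in> S \<longleftrightarrow> i < m \<and> d - 1 \<le> i"
    for i x by (auto simp: S_def)
  have finV: "finite V" by (auto simp: V_def)
  have cardV: "card V = q * (d + 1) + 2 * m"
  proof -
    have "card (case_prod Clq ` ({..<q} \<times> {..d})) = q * (d + 1)"
      by (subst card_image) (auto simp: inj_on_def card_cartesian_product)
    moreover have "card (Lft ` {..<m}) = m" "card (Rgt ` {..<m}) = m"
      by (auto simp: card_image inj_on_def)
    ultimately show ?thesis unfolding V_def
      by (subst card_Un_disjoint; (subst card_Un_disjoint)?) auto
  qed
  have "\<exists>G\<in>regular_graphs (card V) r (q + m). defining_number G \<le> q + m - 1"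
  proof (rule forcing_complement_realization[where V = V and H = H and col = col and rk = rk
        and d = d and I = I and S = S])
    show "finite V" by (rule finV)
    show "card V = r + d + 1" using cardV r by simp
    show "H v u" if "H u v" for u v using that by (auto simp: H_def split: cc_vertex.splits)
    show "\<not> H v v" for v by (auto simp: H_def split: cc_vertex.splits)
    show "card {u\<in>V. H v u} = d" if "v \<in> V" for v
    proof (cases v)
      case (Clq i x)
      then have "{u\<in>V. H v u} = Clq i ` ({..d} - {x})"
        using that by (auto simp: V_def H_def)
      moreover have "card ({..d} - {x}) = d" using that Clq by simp
      ultimately show ?thesis by (simp add: card_image inj_on_def)
    next
      case (Lft i)
      then have im: "i < m" using that by simp
      have "{u\<in>V. H v u} = Rgt ` ({i..<min (i + d) m} \<union> {..<i + d - m})"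
        using m im unfolding Lft by (auto simp: V_def H_def A_def intro!: imageI)
      moreover have "card ({i..<min (i + d) m} \<union> {..<i + d - m}) = d"
        using m im by (subst card_Un_disjoint) auto
      ultimately show ?thesis by (simp add: card_image inj_on_def)
    next
      case (Rgt j)
      then have im: "j < m" using that by simp
      have "{u\<in>V. H v u} = Lft ` ({j + 1 - d..<j + 1} \<union> {j + m - d + 1..<m})"
        using m im unfolding Rgt by (auto simp: V_def H_def A_def intro!: imageI)
      moreover have "card ({j + 1 - d..<j + 1} \<union> {j + m - d + 1..<m}) = d"
        using m im by (subst card_Un_disjoint) auto
      ultimately show ?thesis by (simp add: card_image inj_on_def)
    qed
    show "col v < q + m" if "v \<in> V" for v using that by (cases v) (auto simp: col_def)
    show "H u v" if "u \<in> V" "v \<in> V" "u \<noteq> v" "col u = col v" for u v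
      using that m by (cases u; cases v) (auto simp: col_def H_def A_def)
    show "I \<subseteq> V" by (auto simp: I_def)
    show "card I = q + m" unfolding I_def
      by (subst card_Un_disjoint) (auto simp: card_image inj_on_def)
    show "\<not> H u v" if "u \<in> I" "v \<in> I" "u \<noteq> v" for u v
      using that by (auto simp: I_def H_def)
    show "S \<subseteq> V" using q by (auto simp: S_def)
    have "card S \<le> card ((\<lambda>i. Clq i 0) ` {..<q - 1}) + card (Lft ` {..<min (d - 1) m})
        + card (Rgt ` {d - 1..<m})"
      unfolding S_def by (meson add_le_mono1 card_Un_le le_trans)
    also have "\<dots> = q - 1 + min (d - 1) m + (m - (d - 1))"
      by (simp add: card_image inj_on_def)
    also have "\<dots> = q + m - 1" using q by auto
    finally show "card S \<le> q + m - 1" .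
    show "\<exists>u\<in>V. rk u < rk v \<and> col u = j \<and> \<not> H u v"
      if v: "v \<in> V" "v \<notin> S" and j: "j < q + m" "j \<noteq> col v" for v j
    proof (cases "j < q")
      case True
      show ?thesis
      proof (rule bexI[of _ "Clq j 0"])
        show "rk (Clq j 0) < rk v \<and> col (Clq j 0) = j \<and> \<not> H (Clq j 0) v"
          using v True j by (cases v) (auto simp: rk_def col_def H_def)
      qed (use True in simp)
    next
      case False
      then obtain a where a: "j = q + a" "a < m" using j by (metis add_less_cancel_left le_add_diff_inverse not_less)
      have R: ?thesis if "rk (Rgt a) < rk v" "\<not> H (Rgt a) v"
        using that a by (intro bexI[of _ "Rgt a"]) (auto simp: col_def)
      have L: ?thesis if "rk (Lft a) < rk v" "\<not> H (Lft a) v"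
        using that a by (intro bexI[of _ "Lft a"]) (auto simp: col_def)
      show ?thesis
      proof (cases v)
        case (Clq i x)
        then show ?thesis using L R v by (cases "a < d - 1") (auto simp: rk_def H_def)
      next
        case (Lft i)
        then have i: "i < m" "d - 1 \<le> i" "a \<noteq> i" using v j a by (auto simp: col_def)
        consider "a < d - 1" | "d - 1 \<le> a" "a < i" | "d - 1 \<le> a" "i < a" using i by linarith
        then show ?thesis
        proof cases
          case 1 then show ?thesis using L Lft i by (auto simp: rk_def H_def)
        next
          \<comment> \<open>From \<open>d - 1 \<le> a\<close> and \<open>i < m\<close> it follows
            that \<open>i + d \<le> a + m\<close>, so the wrap-around of \<open>A\<close> does not
            reach \<open>a\<close>.\<close>
          case 2 then show ?thesis using R Lft i m a
            by (auto simp: rk_def H_def A_def)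
        next
          case 3 then show ?thesis using L Lft i a
            by (auto simp: rk_def H_def)
        qed
      next
        case (Rgt i)
        then have i: "i < m" "i < d - 1" "a \<noteq> i" using v j a by (auto simp: col_def)
        consider "a < d - 1" "i < a" | "a < i" | "d - 1 \<le> a" using i by linarith
        then show ?thesis
        proof cases
          \<comment> \<open>As \<open>a \<le> d - 2\<close>, an edge here could only come from the
            wrap-around and would give \<open>m < 2 * d - 2\<close>. This is what
            \<open>2 * d \<le> m + 2\<close> excludes.\<close>
          case 1 then show ?thesis using L Rgt i m a by (auto simp: rk_def H_def A_def)
        next
          case 2 then show ?thesis using R Rgt i
            by (auto simp: rk_def H_def)
        next
          case 3 then show ?thesis using R Rgt i
            by (auto simp: rk_def H_def)
        qed
      qed
    qed
  qed
  then show ?thesis using cardV by simp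
qed

text \<open>The vertices of this graph, found by computer search, are numbered in a forcing order.\<close>

lemma sporadic_10_6_4: "\<exists>G\<in>regular_graphs 10 6 4. defining_number G \<le> 3"
proof -
  define c where "c = [0, 2, 3, 1, 2, 0, 0, 1, 3, 1 :: nat]"
  define E where "E = {(0 :: nat, 7), (4, 5), (4, 6), (2, 9), (3, 8), (1, 2), (1, 8),
    (0, 5), (0, 6), (5, 6), (1, 4), (2, 8), (3, 7), (3, 9), (7, 9 :: nat)}"
  define H where "H u v \<longleftrightarrow> (u, v) \<in> E \<or> (v, u) \<in> E" for u v
  \<comment> \<open>The quantifiers are expanded over explicit numerals so that simplification can
    decide all the finite checks.\<close>
  have all: "(\<forall>v\<in>{..<10}. R v) \<longleftrightarrow> R 0 \<and> R 1 \<and> R 2 \<and> R 3 \<and> R 4 \<and> R 5 \<and> R 6 \<and> R 7 \<and> R 8 \<and> R (9::nat)" for R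
    by (simp add: numeral_eq_Suc lessThan_Suc conj_ac)
  have ex: "(\<exists>v\<in>{..<10}. R v) \<longleftrightarrow> R 0 \<or> R 1 \<or> R 2 \<or> R 3 \<or> R 4 \<or> R 5 \<or> R 6 \<or> R 7 \<or> R 8 \<or> R (9::nat)" for R
    using all[of "\<lambda>v. \<not> R v"] by blast
  have col4: "(\<forall>j<4. R j) \<longleftrightarrow> R 0 \<and> R 1 \<and> R 2 \<and> R (3::nat)" for R
    by (simp add: numeral_eq_Suc less_Suc_eq all_conj_distrib conj_ac)
  let ?V = "{..<10} :: nat set"
  have nb: "{u\<in>?V. H 0 u} = {5, 6, 7}" "{u\<in>?V. H 1 u} = {2, 4, 8}" "{u\<in>?V. H 2 u} = {1, 8, 9}"
    "{u\<in>?V. H 3 u} = {7, 8, 9}" "{u\<in>?V. H 4 u} = {1, 5, 6}" "{u\<in>?V. H 5 u} = {0, 4, 6}"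
    "{u\<in>?V. H 6 u} = {0, 4, 5}" "{u\<in>?V. H 7 u} = {0, 3, 9}" "{u\<in>?V. H 8 u} = {1, 2, 3}"
    "{u\<in>?V. H 9 u} = {2, 3, 7}"
    by (auto simp: H_def E_def)
  have deg: "\<forall>v\<in>?V. card {u\<in>?V. H v u} = 3"
    unfolding all nb by simp
  have col: "\<forall>v\<in>?V. c ! v < 4" unfolding all by (simp add: c_def)
  have same: "\<forall>u\<in>?V. \<forall>v\<in>?V. u \<noteq> v \<longrightarrow> c ! u = c ! v \<longrightarrow> H u v"
    unfolding all by (simp add: c_def H_def E_def)
  \<comment> \<open>These vertices form a 4-clique of the graph, which keeps the chromatic number
    from falling below 4.\<close>
  have indep: "\<forall>u\<in>{0, 4, 8, 9}. \<forall>v\<in>{0, 4, 8, 9}. u \<noteq> v \<longrightarrow> \<not> H u v"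
    by (simp add: H_def E_def)
  have irr: "\<not> H v v" for v by (auto simp: H_def E_def)
  have force: "\<forall>v\<in>?V. v \<notin> {0, 1, 2} \<longrightarrow> (\<forall>j<4. j \<noteq> c ! v \<longrightarrow>
      (\<exists>u\<in>?V. u < v \<and> c ! u = j \<and> \<not> H u v))"
    unfolding all ex col4 by (simp add: c_def H_def E_def)
  have "\<exists>G\<in>regular_graphs (card ?V) 6 4. defining_number G \<le> 4 - 1"
  proof (rule forcing_complement_realization[where V = ?V and H = H and col = "\<lambda>v. c ! v" and rk = id
        and d = 3 and I = "{0, 4, 8, 9}" and S = "{0, 1, 2}"])
    show "\<not> H u v" if "u \<in> {0, 4, 8, 9}" "v \<in> {0, 4, 8, 9}" "u \<noteq> v" for u v
      using indep that by blast
    show "\<not> H v v" for v by (rule irr)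
    show "H v u" if "H u v" for u v using that by (auto simp: H_def)
    show "\<exists>u\<in>?V. id u < id v \<and> c ! u = j \<and> \<not> H u v"
      if "v \<in> ?V" "v \<notin> {0, 1, 2}" "j < 4" "j \<noteq> c ! v" for v j
      using force that by simp
  qed (use deg col same in auto)
  then show ?thesis by simp
qed

subsection \<open>Triples and pairs\<close>

text \<open>Used to count neighborhoods, each of which splits by vertex constructor into three such
  images.\<close>

lemma card_three_images:
  assumes "finite A" "finite B" "finite C" "inj f" "inj g" "inj h"
    and "range f \<inter> range g = {}" "range f \<inter> range h = {}" "range g \<inter> range h = {}"
  shows "card (f ` A \<union> g ` B \<union> h ` C) = card A + card B + card C"
proof -
  have "f ` A \<subseteq> range f" "g ` B \<subseteq> range g" "h ` C \<subseteq> range h" by auto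
  then have "f ` A \<inter> g ` B = {}" "(f ` A \<union> g ` B) \<inter> h ` C = {}" using assms(7-9) by fast+
  then show ?thesis
    using assms(1-6) by (simp add: card_Un_disjoint card_image inj_on_subset[OF _ subset_UNIV])
qed

datatype tp_vertex = TA nat | TB nat | TC nat | PX nat | PY nat

text \<open>
  A slot \<open>s = (l, u)\<close> is a unit of degree missing both at \<open>PX (p - 1 - l)\<close> and at \<open>PY l\<close>. It is
  filled by deleting the edge from \<open>TC (\<kappa> s)\<close> to class \<open>\<gamma> s\<close>.
\<close>

lemma triples_and_pairs:
  fixes t p e r :: nat and D :: "nat \<Rightarrow> nat \<Rightarrow> bool" and \<kappa> \<gamma> :: "nat \<times> nat \<Rightarrow> nat"
  defines "Sl \<equiv> {(l, u). l < p \<and> l + u \<le> e}"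
  assumes t: "t > 0" and r: "3 * t + 2 * p = r + e + 3"
    and D: "\<And>i j. D i j \<Longrightarrow> i < t \<and> j < t \<and> i \<noteq> j" and Dsym: "\<And>i j. D i j \<Longrightarrow> D j i"
    and Ddeg: "\<And>i. i < t \<Longrightarrow> card {j. D i j} = e"
    and slot: "\<And>s. s \<in> Sl \<Longrightarrow> D (\<kappa> s) (\<gamma> s)"
    and inj1: "inj_on (\<lambda>s. (\<kappa> s, \<gamma> s)) Sl"
    and inj2: "inj_on (\<lambda>s. (fst s, \<kappa> s)) Sl"
    and inj3: "inj_on (\<lambda>s. (fst s, \<gamma> s)) Sl"
  shows "\<exists>G\<in>regular_graphs (3 * t + 2 * p) r (t + p). defining_number G \<le> t + p - 1"
proof -
  define R where "R = (\<lambda>s. (\<kappa> s, \<gamma> s)) ` Sl"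
  define V where "V = TA ` {..<t} \<union> TB ` {..<t} \<union> TC ` {..<t} \<union> (PX ` {..<p} \<union> PY ` {..<p})"
  \<comment> \<open>Each edge of \<open>H\<close> is listed from one end. The equalities
    \<open>i = j\<close> yield the triples, and \<open>q = q'\<close> yields the pairs. A slot
    deletes the edge from \<open>TC\<close> to \<open>TA\<close> if
    \<open>\<kappa> s < \<gamma> s\<close> and to \<open>TB\<close> otherwise, and the same vertex
    is then joined to \<open>PY\<close>. The equation \<open>p = Suc (q + fst s)\<close> says
    \<open>q = p - 1 - fst s\<close> without truncated subtraction.\<close>
  define B where "B u v = (case (u, v) of
      (TA i, TB j) \<Rightarrow> i = j \<or> i < j \<and> D i j
    | (TC i, TA j) \<Rightarrow> i = j \<or> i < j \<and> D i j \<and> (i, j) \<notin> R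
    | (TC i, TB j) \<Rightarrow> i = j \<or> j < i \<and> D i j \<and> (i, j) \<notin> R
    | (TC i, PX q) \<Rightarrow> \<exists>s\<in>Sl. \<kappa> s = i \<and> p = Suc (q + fst s)
    | (TA j, PY q) \<Rightarrow> \<exists>s\<in>Sl. \<gamma> s = j \<and> \<kappa> s < j \<and> fst s = q
    | (TB j, PY q) \<Rightarrow> \<exists>s\<in>Sl. \<gamma> s = j \<and> j < \<kappa> s \<and> fst s = q
    | (PX q, PY q') \<Rightarrow> q \<le> q' \<and> q' \<le> q + e + 1
    | _ \<Rightarrow> False)" for u v
  define H where "H u v \<longleftrightarrow> B u v \<or> B v u" for u v
  define col where "col v = (case v of TA i \<Rightarrow> i | TB i \<Rightarrow> i | TC i \<Rightarrow> i | PX i \<Rightarrow> t + i | PY i \<Rightarrow> t + i)" for v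
  \<comment> \<open>\<open>TA 0\<close> is the only vertex of \<open>I\<close> outside
    \<open>S\<close>, and it is forced at once by the rest of \<open>I\<close>. The offsets put
    every \<open>PY\<close> after all \<open>TB\<close>, and every \<open>TC\<close> last.\<close>
  define rk where "rk v = (case v of TA i \<Rightarrow> if i = 0 then 1 else 0 | PX i \<Rightarrow> 0
    | TB i \<Rightarrow> 2 + i | PY i \<Rightarrow> 2 + t + i | TC i \<Rightarrow> 2 + t + p)" for v
  define I where "I = TA ` {..<t} \<union> PX ` {..<p}"
  define S where "S = TA ` {1..<t} \<union> PX ` {..<p}"
  have V_iff [simp]: "TA i \<in> V \<longleftrightarrow> i < t" "TB i \<in> V \<longleftrightarrow> i < t" "TC i \<in> V \<longleftrightarrow> i < t"
    "PX i \<in> V \<longleftrightarrow> i < p" "PY i \<in> V \<longleftrightarrow> i < p" for i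
    by (auto simp: V_def)
  have S_iff [simp]: "TA i \<in> S \<longleftrightarrow> 0 < i \<and> i < t" "PX i \<in> S \<longleftrightarrow> i < p"
    "TB i \<notin> S" "TC i \<notin> S" "PY i \<notin> S" for i
    by (auto simp: S_def)
  have finV: "finite V" by (simp add: V_def)
  have "card (PX ` {..<p} \<union> PY ` {..<p}) = 2 * p"
    by (subst card_Un_disjoint) (auto simp: card_image inj_on_def)
  then have cardV: "card V = 3 * t + 2 * p"
    unfolding V_def
    by (subst card_Un_disjoint, simp, simp, force, subst card_three_images) (auto simp: inj_def)
  have "Sl \<subseteq> {..p} \<times> {..e}" by (auto simp: Sl_def)
  then have finSl: "finite Sl" by (rule finite_subset) simp
  have slD: "\<kappa> s < t" "\<gamma> s < t" "\<kappa> s \<noteq> \<gamma> s" "D (\<gamma> s) (\<kappa> s)" if "s \<in> Sl" for s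
    using slot[OF that] D Dsym by blast+
  have finD: "finite {j. D i j}" for i
    using finite_subset[of "{j. D i j}" "{..<t}"] D by auto
  have finDs: "finite {j. j < i \<and> D i j}" "finite {j. i < j \<and> D i j}" for i
    using finD[of i] by (auto intro: rev_finite_subset)
  have split: "card {j. j < i \<and> D i j} + card {j. i < j \<and> D i j} = e" if "i < t" for i
  proof -
    have eq: "{j. D i j} = {j. j < i \<and> D i j} \<union> {j. i < j \<and> D i j}"
      using D by (auto simp: nat_neq_iff)
    have "card {j. D i j} = card {j. j < i \<and> D i j} + card {j. i < j \<and> D i j}"
      unfolding eq by (rule card_Un_disjoint[OF finDs]) auto
    then show ?thesis using Ddeg[OF that] by simp
  qed
  \<comment> \<open>For \<open>l \<le> e\<close>, \<open>PY l\<close> has only \<open>l + 1\<close>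
    of its \<open>e + 2\<close> neighbors among the \<open>PX\<close>, so row \<open>l\<close> holds
    exactly the missing units. For \<open>l > e\<close> nothing is missing and the subtraction
    truncates to 0.\<close>
  have row: "card {s\<in>Sl. fst s = l} = e + 1 - l" if "l < p" for l
  proof -
    have "{s\<in>Sl. fst s = l} = Pair l ` {..<e + 1 - l}"
      using that by (auto simp: Sl_def image_iff)
    then show ?thesis by (simp add: card_image inj_on_def)
  qed
  \<comment> \<open>Different slots delete different edges, and by the next two facts no new edge at
    a \<open>PX\<close> or a \<open>PY\<close> is counted twice. So each deletion is repaid by
    exactly one new edge at both of its ends.\<close>
  have i1: "s = s'" if "s \<in> Sl" "s' \<in> Sl" "\<kappa> s = \<kappa> s'" "\<gamma> s = \<gamma> s'" for s s'
    using inj1 that by (auto simp: inj_on_def)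
  have i2: "s = s'" if "s \<in> Sl" "s' \<in> Sl" "fst s = fst s'" "\<kappa> s = \<kappa> s'" for s s'
    using inj2 that unfolding inj_on_def by (metis (no_types, lifting))
  have i3: "s = s'" if "s \<in> Sl" "s' \<in> Sl" "fst s = fst s'" "\<gamma> s = \<gamma> s'" for s s'
    using inj3 that unfolding inj_on_def by (metis (no_types, lifting))
  have Dc: "D i j \<longleftrightarrow> D j i" for i j using Dsym by blast
  have R_iff: "(i, j) \<in> R \<longleftrightarrow> (\<exists>s\<in>Sl. \<kappa> s = i \<and> \<gamma> s = j)" for i j by (auto simp: R_def)
  have H_simps:
    "H (TA i) (TA j) = False" "H (TA i) (TB j) \<longleftrightarrow> i = j \<or> i < j \<and> D i j"
    "H (TA i) (TC j) \<longleftrightarrow> i = j \<or> j < i \<and> D i j \<and> (j, i) \<notin> R"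
    "H (TA i) (PX q) = False" "H (TA i) (PY q) \<longleftrightarrow> (\<exists>s\<in>Sl. \<gamma> s = i \<and> \<kappa> s < i \<and> fst s = q)"
    "H (TB i) (TA j) \<longleftrightarrow> i = j \<or> j < i \<and> D i j" "H (TB i) (TB j) = False"
    "H (TB i) (TC j) \<longleftrightarrow> i = j \<or> i < j \<and> D i j \<and> (j, i) \<notin> R"
    "H (TB i) (PX q) = False" "H (TB i) (PY q) \<longleftrightarrow> (\<exists>s\<in>Sl. \<gamma> s = i \<and> i < \<kappa> s \<and> fst s = q)"
    "H (TC i) (TA j) \<longleftrightarrow> i = j \<or> i < j \<and> D i j \<and> (i, j) \<notin> R"
    "H (TC i) (TB j) \<longleftrightarrow> i = j \<or> j < i \<and> D i j \<and> (i, j) \<notin> R" "H (TC i) (TC j) = False"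
    "H (TC i) (PX q) \<longleftrightarrow> (\<exists>s\<in>Sl. \<kappa> s = i \<and> p = Suc (q + fst s))" "H (TC i) (PY q) = False"
    "H (PX q) (TA i) = False" "H (PX q) (TB i) = False" "H (PX q) (PX q') = False"
    "H (PX q) (TC i) \<longleftrightarrow> (\<exists>s\<in>Sl. \<kappa> s = i \<and> p = Suc (q + fst s))"
    "H (PX q) (PY q') \<longleftrightarrow> q \<le> q' \<and> q' \<le> q + e + 1"
    "H (PY q) (TA i) \<longleftrightarrow> (\<exists>s\<in>Sl. \<gamma> s = i \<and> \<kappa> s < i \<and> fst s = q)"
    "H (PY q) (TB i) \<longleftrightarrow> (\<exists>s\<in>Sl. \<gamma> s = i \<and> i < \<kappa> s \<and> fst s = q)"
    "H (PY q) (TC i) = False" "H (PY q') (PX q) \<longleftrightarrow> q \<le> q' \<and> q' \<le> q + e + 1" "H (PY q) (PY q') = False"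
    for i j q q' by (simp_all add: H_def B_def Dc[of i j] eq_commute[of j i])
  have Sl_lt: "fst s < p" if "s \<in> Sl" for s using that by (auto simp: Sl_def)
  have deg: "card {u\<in>V. H v u} = e + 2" if "v \<in> V" for v
  proof (cases v)
    case (TA i)
    then have it: "i < t" using that by simp
    \<comment> \<open>The slots that delete an edge at \<open>TA i\<close>: each costs a
      \<open>TC\<close> neighbor and brings a \<open>PY\<close> neighbor. The other triple vertices
      are counted in the same way.\<close>
    define X where "X = {s\<in>Sl. \<gamma> s = i \<and> \<kappa> s < i}"
    have finX: "finite X" using finSl by (simp add: X_def)
    have nb: "{u\<in>V. H v u} = TB ` (insert i {j. i < j \<and> D i j})
        \<union> TC ` (insert i ({j. j < i \<and> D i j} - \<kappa> ` X)) \<union> PY ` (fst ` X)"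
      (is "_ = ?N")
    proof (rule set_eqI)
      fix u show "u \<in> {u\<in>V. H v u} \<longleftrightarrow> u \<in> ?N"
        using it D[of i] Sl_lt unfolding TA
        by (cases u) (auto simp: H_simps R_iff X_def image_iff)
    qed
    have "\<kappa> ` X \<subseteq> {j. j < i \<and> D i j}" using slD by (auto simp: X_def)
    then have "card ({j. j < i \<and> D i j} - \<kappa> ` X) + card X = card {j. j < i \<and> D i j}"
      using finX finD[of i] i1 card_mono[of "{j. j < i \<and> D i j}" "\<kappa> ` X"]
      by (subst card_Diff_subset) (auto simp: card_image inj_on_def X_def)
    moreover have "card (fst ` X) = card X"
      using i3 by (intro card_image) (auto simp: inj_on_def X_def)
    ultimately show ?thesis
      using split[OF it] finX finDs[of i] unfolding nb
      by (subst card_three_images) (auto simp: inj_def card_insert_if)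
  next
    case (TB i)
    then have it: "i < t" using that by simp
    define X where "X = {s\<in>Sl. \<gamma> s = i \<and> i < \<kappa> s}"
    have finX: "finite X" using finSl by (simp add: X_def)
    have nb: "{u\<in>V. H v u} = TA ` (insert i {j. j < i \<and> D i j})
        \<union> TC ` (insert i ({j. i < j \<and> D i j} - \<kappa> ` X)) \<union> PY ` (fst ` X)"
      (is "_ = ?N")
    proof (rule set_eqI)
      fix u show "u \<in> {u\<in>V. H v u} \<longleftrightarrow> u \<in> ?N"
        using it D[of i] Sl_lt unfolding TB
        by (cases u) (auto simp: H_simps R_iff X_def image_iff)
    qed
    have "\<kappa> ` X \<subseteq> {j. i < j \<and> D i j}" using slD by (auto simp: X_def)
    then have "card ({j. i < j \<and> D i j} - \<kappa> ` X) + card X = card {j. i < j \<and> D i j}"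
      using finX finD[of i] i1 card_mono[of "{j. i < j \<and> D i j}" "\<kappa> ` X"]
      by (subst card_Diff_subset) (auto simp: card_image inj_on_def X_def)
    moreover have "card (fst ` X) = card X"
      using i3 by (intro card_image) (auto simp: inj_on_def X_def)
    ultimately show ?thesis
      using split[OF it] finX finDs[of i] unfolding nb
      by (subst card_three_images) (auto simp: inj_def card_insert_if)
  next
    case (TC i)
    then have it: "i < t" using that by simp
    define X where "X = {s\<in>Sl. \<kappa> s = i \<and> i < \<gamma> s}"
    define Y where "Y = {s\<in>Sl. \<kappa> s = i \<and> \<gamma> s < i}"
    have finXY: "finite X" "finite Y" using finSl by (simp_all add: X_def Y_def)
    have XY: "X \<union> Y = {s\<in>Sl. \<kappa> s = i}" using slD(3) by (auto simp: X_def Y_def nat_neq_iff)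
    have nb: "{u\<in>V. H v u} = TA ` (insert i ({j. i < j \<and> D i j} - \<gamma> ` X))
        \<union> TB ` (insert i ({j. j < i \<and> D i j} - \<gamma> ` Y)) \<union> PX ` ((\<lambda>s. p - Suc (fst s)) ` (X \<union> Y))"
      (is "_ = ?N")
    proof (rule set_eqI)
      fix u
      have PX: "PX q \<in> {u\<in>V. H v u} \<longleftrightarrow> PX q \<in> ?N" for q
      proof -
        have "p = Suc (q + fst s) \<longleftrightarrow> q = p - Suc (fst s)" if "s \<in> Sl" for s
          using Sl_lt[OF that] by auto
        then have "(\<exists>s\<in>Sl. \<kappa> s = i \<and> p = Suc (q + fst s)) \<longleftrightarrow> (\<exists>s\<in>X \<union> Y. q = p - Suc (fst s))"
          unfolding XY by blast
        moreover have "q < p" if "p = Suc (q + fst s)" for s :: "nat \<times> nat"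
          using that by simp
        ultimately show ?thesis unfolding TC by (auto simp: H_simps image_iff)
      qed
      show "u \<in> {u\<in>V. H v u} \<longleftrightarrow> u \<in> ?N"
        using it D[of i] PX unfolding TC
        by (cases u) (auto simp: H_simps R_iff X_def Y_def image_iff)
    qed
    have "\<gamma> ` X \<subseteq> {j. i < j \<and> D i j}" using slot by (auto simp: X_def)
    then have "card ({j. i < j \<and> D i j} - \<gamma> ` X) + card X = card {j. i < j \<and> D i j}"
      using finXY finD[of i] i1 card_mono[of "{j. i < j \<and> D i j}" "\<gamma> ` X"]
      by (subst card_Diff_subset) (auto simp: card_image inj_on_def X_def)
    moreover have "\<gamma> ` Y \<subseteq> {j. j < i \<and> D i j}" using slot by (auto simp: Y_def)
    then have "card ({j. j < i \<and> D i j} - \<gamma> ` Y) + card Y = card {j. j < i \<and> D i j}"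
      using finXY finD[of i] i1 card_mono[of "{j. j < i \<and> D i j}" "\<gamma> ` Y"]
      by (subst card_Diff_subset) (auto simp: card_image inj_on_def Y_def)
    moreover have "inj_on (\<lambda>s. p - Suc (fst s)) (X \<union> Y)"
    proof (rule inj_onI)
      fix s s' assume s: "s \<in> X \<union> Y" "s' \<in> X \<union> Y" "p - Suc (fst s) = p - Suc (fst s')"
      then have "fst s < p" "fst s' < p" by (auto simp: X_def Y_def Sl_def)
      then have "fst s = fst s'" using s(3) by linarith
      moreover have "s \<in> Sl" "s' \<in> Sl" "\<kappa> s = \<kappa> s'" using s XY by auto
      ultimately show "s = s'" using i2 by blast
    qed
    then have "card ((\<lambda>s. p - Suc (fst s)) ` (X \<union> Y)) = card X + card Y"
      using finXY by (subst card_image) (auto simp: X_def Y_def intro: card_Un_disjoint)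
    ultimately show ?thesis
      using split[OF it] finXY finDs[of i] unfolding nb
      by (subst card_three_images) (auto simp: inj_def card_insert_if)
  next
    case (PX q)
    then have qp: "q < p" using that by simp
    define X where "X = {s\<in>Sl. fst s = p - Suc q}"
    have finX: "finite X" using finSl by (simp add: X_def)
    \<comment> \<open>The empty image of \<open>TA\<close> only gives the union the shape that
      \<open>card_three_images\<close> expects.\<close>
    have nb: "{u\<in>V. H v u} = PY ` {q..<min (q + e + 2) p} \<union> TC ` (\<kappa> ` X) \<union> TA ` {}"
      (is "_ = ?N")
    proof (rule set_eqI)
      fix u show "u \<in> {u\<in>V. H v u} \<longleftrightarrow> u \<in> ?N"
        using qp slD(1) unfolding PX
        by (cases u) (auto simp: H_simps X_def image_iff)
    qed
    have "card (\<kappa> ` X) = e + 1 - (p - Suc q)"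
      using row[of "p - Suc q"] qp i2 by (subst card_image) (auto simp: inj_on_def X_def)
    then show ?thesis
      using finX qp unfolding nb
      by (subst card_three_images) (auto simp: inj_def card_insert_if)
  next
    case (PY q)
    then have qp: "q < p" using that by simp
    define X where "X = {s\<in>Sl. fst s = q \<and> \<kappa> s < \<gamma> s}"
    define Y where "Y = {s\<in>Sl. fst s = q \<and> \<gamma> s < \<kappa> s}"
    have finXY: "finite X" "finite Y" using finSl by (simp_all add: X_def Y_def)
    have nb: "{u\<in>V. H v u} = PX ` {q - (e + 1)..<q + 1} \<union> TA ` (\<gamma> ` X) \<union> TB ` (\<gamma> ` Y)"
      (is "_ = ?N")
    proof (rule set_eqI)
      fix u show "u \<in> {u\<in>V. H v u} \<longleftrightarrow> u \<in> ?N"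
        using qp slD(2) unfolding PY
        by (cases u) (auto simp: H_simps X_def Y_def image_iff)
    qed
    have "card (\<gamma> ` X) = card X" "card (\<gamma> ` Y) = card Y"
      using i3 by (auto simp: inj_on_def X_def Y_def intro!: card_image)
    moreover have "X \<union> Y = {s\<in>Sl. fst s = q}" using slD(3) by (auto simp: X_def Y_def nat_neq_iff)
    then have "card X + card Y = e + 1 - q"
      using row[OF qp] finXY by (subst card_Un_disjoint[symmetric]) (auto simp: X_def Y_def)
    ultimately show ?thesis
      using finXY qp unfolding nb
      by (subst card_three_images) (auto simp: inj_def card_insert_if)
  qed
  have "\<exists>G\<in>regular_graphs (card V) r (t + p). defining_number G \<le> t + p - 1"
  proof (rule forcing_complement_realization[where V = V and H = H and col = col and rk = rk
        and d = "e + 2" and I = I and S = S])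
    show "finite V" by (rule finV)
    show "card V = r + (e + 2) + 1" using cardV r by simp
    show "H v u" if "H u v" for u v using that by (auto simp: H_def)
    show "\<not> H v v" for v by (cases v) (auto simp: H_simps)
    show "card {u\<in>V. H v u} = e + 2" if "v \<in> V" for v using deg that .
    show "col v < t + p" if "v \<in> V" for v using that by (cases v) (auto simp: col_def)
    show "H u v" if "u \<in> V" "v \<in> V" "u \<noteq> v" "col u = col v" for u v
      using that by (cases u; cases v) (auto simp: col_def H_simps)
    show "I \<subseteq> V" by (auto simp: I_def)
    show "card I = t + p" unfolding I_def
      by (subst card_Un_disjoint) (auto simp: card_image inj_on_def)
    show "\<not> H u v" if "u \<in> I" "v \<in> I" "u \<noteq> v" for u v
      using that by (auto simp: I_def H_simps)
    show "S \<subseteq> V" by (auto simp: S_def)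
    have "card S = (t - 1) + p" unfolding S_def
      by (subst card_Un_disjoint) (auto simp: card_image inj_on_def)
    then show "card S \<le> t + p - 1" using t by simp
    show "\<exists>u\<in>V. rk u < rk v \<and> col u = j \<and> \<not> H u v"
      if v: "v \<in> V" "v \<notin> S" and j: "j < t + p" "j \<noteq> col v" for v j
    proof (cases "j < t")
      case True
      \<comment> \<open>For \<open>TB i\<close> the witness is \<open>TB j\<close> if
        \<open>j < i\<close> and \<open>TA j\<close> if \<open>j > i\<close>; for
        \<open>TC i\<close> it is \<open>TA j\<close> if \<open>j < i\<close> and
        \<open>TB j\<close> if \<open>j > i\<close>. The cyclic orientation of the edges of
        \<open>H\<close> leaves these pairs nonadjacent in \<open>H\<close>.\<close>
      have A: ?thesis if "rk (TA j) < rk v" "\<not> H (TA j) v"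
        using that True by (intro bexI[of _ "TA j"]) (auto simp: col_def)
      have B: ?thesis if "rk (TB j) < rk v" "\<not> H (TB j) v"
        using that True by (intro bexI[of _ "TB j"]) (auto simp: col_def)
      show ?thesis
      proof (cases v)
        case (TA i)
        then show ?thesis using A v j by (auto simp: rk_def H_simps col_def)
      next
        case (TB i)
        then show ?thesis using A B j
          by (cases "j < i") (auto simp: rk_def H_simps col_def)
      next
        case (TC i)
        then show ?thesis using A B j True
          by (cases "j < i") (auto simp: rk_def H_simps col_def)
      next
        case (PX q)
        then show ?thesis using v by simp
      next
        case (PY q)
        \<comment> \<open>Both edges would come from slots of row \<open>q\<close> with
          \<open>\<gamma>\<close> equal to \<open>j\<close>. There is at most one such slot, and its
          \<open>\<kappa>\<close> cannot lie on both sides of \<open>j\<close>.\<close>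
        have "\<not> H (TA j) v \<or> \<not> H (TB j) v"
        proof (rule ccontr)
          assume "\<not> ?thesis"
          then obtain s s' where "s \<in> Sl" "s' \<in> Sl" "\<gamma> s = j" "\<gamma> s' = j" "fst s = q" "fst s' = q"
            "\<kappa> s < j" "j < \<kappa> s'"
            by (auto simp: PY H_simps)
          then show False using i3[of s s'] by auto
        qed
        then show ?thesis using A B PY True by (auto simp: rk_def)
      qed
    next
      case False
      then obtain a where a: "j = t + a" "a < p"
        using j by (metis add_less_cancel_left le_add_diff_inverse not_less)
      have X: ?thesis if "rk (PX a) < rk v" "\<not> H (PX a) v"
        using that a by (intro bexI[of _ "PX a"]) (auto simp: col_def)
      have Y: ?thesis if "rk (PY a) < rk v" "\<not> H (PY a) v"
        using that a by (intro bexI[of _ "PY a"]) (auto simp: col_def)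
      show ?thesis
      proof (cases v)
        case (PY q)
        then show ?thesis using X Y j a
          by (cases "a < q") (auto simp: rk_def H_simps col_def)
      qed (use X Y v a in \<open>auto simp: rk_def H_simps\<close>)
    qed
  qed
  then show ?thesis using cardV by simp
qed

section \<open>Filling the slots from a circulant graph\<close>

lemma add_mod_left_cancel:
  fixes a x y t :: nat
  assumes "(a + x) mod t = (a + y) mod t" "x < t" "y < t"
  shows "x = y"
proof -
  have "x = y" if "(a + x) mod t = (a + y) mod t" "x < t" "y \<le> x" for x y
  proof -
    have "t dvd (a + x) - (a + y)" using that mod_eq_dvd_iff_nat[of "a + y" "a + x" t] by simp
    then have "t dvd x - y" by simp
    then show ?thesis using that dvd_imp_le[of t "x - y"] by (cases "x = y") auto
  qed
  then show ?thesis using assms by (metis nat_le_linear)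
qed

text \<open>Take the differences \<plusminus>1, ..., \<plusminus>h modulo \<open>t\<close>. For odd
  \<open>e\<close> add the self-inverse difference \<open>t / 2\<close>, available because
  \<open>t\<close> is then even.\<close>

lemma symmetric_connection_set:
  fixes t e :: nat
  assumes "e < t" "even (t * e)"
  shows "\<exists>\<Delta>\<subseteq>{1..<t}. card \<Delta> = e \<and> (\<forall>x\<in>\<Delta>. t - x \<in> \<Delta>)"
proof (cases "even e")
  case True
  then obtain h where h: "e = 2 * h" by blast
  have "card ({1..h} \<union> {t - h..<t}) = e"
    using assms h by (subst card_Un_disjoint) auto
  then show ?thesis
    using assms h by (intro exI[of _ "{1..h} \<union> {t - h..<t}"]) auto
next
  case False
  then obtain h where h: "e = 2 * h + 1" by (rule oddE)
  obtain g where g: "t = 2 * g" using assms False by auto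
  have hg: "h < g" using assms h g by simp
  have "card ({1..h} \<union> {t - h..<t}) = 2 * h"
    using hg g by (subst card_Un_disjoint) auto
  then have "card (insert g ({1..h} \<union> {t - h..<t})) = e"
    using hg g h by (subst card_insert_disjoint) auto
  then show ?thesis
    using hg g by (intro exI[of _ "insert g ({1..h} \<union> {t - h..<t})"]) auto
qed

text \<open>
  Row \<open>l < e\<close> of slots takes its edges from the \<open>l\<close>-th difference. There is no difference left for
  row \<open>e\<close>, a single slot, which takes the unused edge of difference \<open>l0\<close> at \<open>u0\<close>.
\<close>

lemma triples_and_pairs_circulant:
  fixes t p e r l0 u0 :: nat
  assumes e: "0 < e" "e < t" and ev: "even (t * e)" and r: "3 * t + 2 * p = r + e + 3"
    and extra: "p \<le> e \<or> l0 < e \<and> u0 < t \<and> e < l0 + u0"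
  shows "\<exists>G\<in>regular_graphs (3 * t + 2 * p) r (t + p). defining_number G \<le> t + p - 1"
proof -
  obtain \<Delta> where \<Delta>: "\<Delta> \<subseteq> {1..<t}" "card \<Delta> = e" "\<And>x. x \<in> \<Delta> \<Longrightarrow> t - x \<in> \<Delta>"
    using symmetric_connection_set[OF e(2) ev] by blast
  have fin: "finite \<Delta>" using \<Delta>(1) finite_subset by blast
  obtain \<delta> where "bij_betw \<delta> {0..<e} \<Delta>" using ex_bij_betw_nat_finite[OF fin] \<Delta>(2) by blast
  then have \<delta>: "\<And>l. l < e \<Longrightarrow> \<delta> l \<in> \<Delta>" and inj\<delta>: "\<And>l l'. \<lbrakk>l < e; l' < e; \<delta> l = \<delta> l'\<rbrakk> \<Longrightarrow> l = l'"
    by (auto simp: bij_betw_def inj_on_def)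
  define D where "D i j \<longleftrightarrow> i < t \<and> (\<exists>x\<in>\<Delta>. j = (i + x) mod t)" for i j
  define Sl where "Sl = {(l, u). l < p \<and> l + u \<le> e}"
  \<comment> \<open>The pair \<open>(l0, u0)\<close> is not itself a slot of row \<open>l0\<close>,
    because \<open>e < l0 + u0\<close>; so its edge is still free. If \<open>p \<le> e\<close>, row
    \<open>e\<close> does not occur.\<close>
  define lev where "lev s = (if fst s < e then fst s else l0)" for s :: "nat \<times> nat"
  define \<kappa> where "\<kappa> s = (if fst s < e then snd s else u0)" for s :: "nat \<times> nat"
  define \<gamma> where "\<gamma> s = (\<kappa> s + \<delta> (lev s)) mod t" for s
  have lev: "lev s < e" "\<kappa> s < t" if "s \<in> Sl" for s
    using that e extra by (auto simp: Sl_def lev_def \<kappa>_def)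
  have lev_inj: "s = s'" if "s \<in> Sl" "s' \<in> Sl" "lev s = lev s'" "\<kappa> s = \<kappa> s'" for s s'
    using that extra by (auto simp: Sl_def lev_def \<kappa>_def split: if_splits)
  have row_inj: "s = s'" if "s \<in> Sl" "s' \<in> Sl" "fst s = fst s'" "\<kappa> s = \<kappa> s'" for s s'
    using that by (auto simp: Sl_def \<kappa>_def split: if_splits)
  have lt: "\<delta> l < t" if "l < e" for l using \<delta>[OF that] \<Delta>(1) by auto
  show ?thesis
  proof (rule triples_and_pairs[where D = D and \<kappa> = \<kappa> and \<gamma> = \<gamma> and e = e])
    show "t > 0" using e by simp
    show "3 * t + 2 * p = r + e + 3" by (rule r)
    show "i < t \<and> j < t \<and> i \<noteq> j" if ij: "D i j" for i j
    proof -
      obtain x where x: "x \<in> \<Delta>" "j = (i + x) mod t" and i: "i < t" using ij by (auto simp: D_def)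
      have "x < t" "x \<noteq> 0" using x(1) \<Delta>(1) by auto
      then have "j \<noteq> i" using add_mod_left_cancel[of i x t 0] x(2) i by auto
      then show ?thesis using x i e by auto
    qed
    show "D j i" if ij: "D i j" for i j
    proof -
      obtain x where x: "x \<in> \<Delta>" "j = (i + x) mod t" and i: "i < t" using ij by (auto simp: D_def)
      have "x \<le> t" using x(1) \<Delta>(1) by auto
      then have "(j + (t - x)) mod t = i"
        unfolding x(2) mod_add_left_eq using i by simp
      moreover have "j < t" using x(2) e by simp
      ultimately show ?thesis using \<Delta>(3)[OF x(1)] unfolding D_def by blast
    qed
    show "card {j. D i j} = e" if "i < t" for i
    proof -
      have "{j. D i j} = (\<lambda>x. (i + x) mod t) ` \<Delta>" using that by (auto simp: D_def)
      moreover have "inj_on (\<lambda>x. (i + x) mod t) \<Delta>"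
      proof (rule inj_onI)
        fix x y assume "x \<in> \<Delta>" "y \<in> \<Delta>" and eq: "(i + x) mod t = (i + y) mod t"
        then have "x < t" "y < t" using \<Delta>(1) by auto
        then show "x = y" by (rule add_mod_left_cancel[OF eq])
      qed
      ultimately show ?thesis using \<Delta>(2) by (simp add: card_image)
    qed
    show "D (\<kappa> s) (\<gamma> s)" if "s \<in> {(l, u). l < p \<and> l + u \<le> e}" for s
      using lev[OF that[folded Sl_def]] \<delta> by (auto simp: D_def \<gamma>_def)
    show "inj_on (\<lambda>s. (\<kappa> s, \<gamma> s)) {(l, u). l < p \<and> l + u \<le> e}"
      unfolding Sl_def[symmetric]
    proof (rule inj_onI)
      fix s s' assume s: "s \<in> Sl" "s' \<in> Sl" "(\<kappa> s, \<gamma> s) = (\<kappa> s', \<gamma> s')"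
      then have \<kappa>: "\<kappa> s = \<kappa> s'" and "(\<kappa> s + \<delta> (lev s)) mod t = (\<kappa> s + \<delta> (lev s')) mod t"
        by (auto simp: \<gamma>_def)
      then have "\<delta> (lev s) = \<delta> (lev s')"
        using add_mod_left_cancel lt lev(1) s by blast
      then have "lev s = lev s'" using inj\<delta> lev(1) s by blast
      then show "s = s'" using lev_inj s \<kappa> by blast
    qed
    show "inj_on (\<lambda>s. (fst s, \<kappa> s)) {(l, u). l < p \<and> l + u \<le> e}"
      unfolding Sl_def[symmetric]
      by (intro inj_onI row_inj) auto
    show "inj_on (\<lambda>s. (fst s, \<gamma> s)) {(l, u). l < p \<and> l + u \<le> e}"
      unfolding Sl_def[symmetric]
    proof (rule inj_onI)
      fix s s' assume s: "s \<in> Sl" "s' \<in> Sl" "(fst s, \<gamma> s) = (fst s', \<gamma> s')"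
      \<comment> \<open>Inside one row the difference is constant, so \<open>\<gamma>\<close>
        determines \<open>\<kappa>\<close>.\<close>
      then have "lev s = lev s'" by (simp add: lev_def)
      then have "(\<delta> (lev s) + \<kappa> s) mod t = (\<delta> (lev s) + \<kappa> s') mod t"
        using s(3) by (simp add: \<gamma>_def add.commute)
      then have "\<kappa> s = \<kappa> s'" using add_mod_left_cancel lev s by blast
      then show "s = s'" using s row_inj by blast
    qed
  qed
qed

subsection \<open>Constraints on the parameters\<close>

lemma regular_degree:
  "regular G r \<Longrightarrow> v \<in> pverts G \<Longrightarrow> card {u. (v, u) \<in> parcs G} = r"
  by (simp add: regular_def out_degree_with_proj)

text \<open>Counting arcs by their tails gives \<open>n * r\<close>, and reversal pairs the
  increasing arcs with the decreasing ones.\<close>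

lemma regular_handshake:
  fixes G :: "nat pair_pre_digraph"
  assumes "pair_graph G" "regular G r"
  shows "even (card (pverts G) * r)"
proof -
  interpret pair_graph G by fact
  have "parcs G = Sigma (pverts G) (\<lambda>v. {u. (v, u) \<in> parcs G})"
    using in_arcsD1 by auto
  moreover have "finite {u. (v, u) \<in> parcs G}" for v
    by (rule finite_subset[OF _ pair_finite_verts]) (use in_arcsD2 in auto)
  ultimately have "card (parcs G) = (\<Sum>v\<in>pverts G. card {u. (v, u) \<in> parcs G})"
    using card_SigmaI[OF pair_finite_verts, of "\<lambda>v. {u. (v, u) \<in> parcs G}"] by simp
  also have "\<dots> = card (pverts G) * r"
    using regular_degree[OF assms(2)] by simp
  finally have "card (parcs G) = card (pverts G) * r" .
  moreover have "even (card (parcs G))"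
  proof -
    let ?L = "{(u, v) \<in> parcs G. u < v}"
    have sym: "(u, v) \<in> parcs G \<longleftrightarrow> (v, u) \<in> parcs G" for u v
      using pair_sym_arcs by (auto simp: symmetric_def dest: symD)
    have eq: "parcs G = ?L \<union> prod.swap ` ?L"
      using sym no_loops' by (force simp: image_iff nat_neq_iff)
    have "finite ?L" by (rule finite_subset[OF _ pair_finite_arcs]) auto
    then have "card (?L \<union> prod.swap ` ?L) = card ?L + card (prod.swap ` ?L)"
      by (intro card_Un_disjoint) auto
    moreover have "card (prod.swap ` ?L) = card ?L"
      by (intro card_image) (auto simp: inj_on_def)
    ultimately have "card (?L \<union> prod.swap ` ?L) = 2 * card ?L" by simp
    then show ?thesis by (subst eq) simp
  qed
  ultimately show ?thesis by simp
qed

text \<open>The color class of \<open>v\<close> and the \<open>r\<close> neighbors of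
  \<open>v\<close> are disjoint. If together they exhaust the graph, every vertex outside the class
  is a neighbor.\<close>

lemma color_class_card:
  assumes "pair_graph G" "regular G r" and c: "c \<in> proper_colorings G k" and v: "v \<in> pverts G"
  shows "card {u\<in>pverts G. c u = c v} + r \<le> card (pverts G)"
    and "card {u\<in>pverts G. c u = c v} + r = card (pverts G) \<Longrightarrow>
      \<forall>w\<in>pverts G. c w \<noteq> c v \<longrightarrow> (v, w) \<in> parcs G"
proof -
  interpret pair_graph G by fact
  let ?C = "{u\<in>pverts G. c u = c v}" and ?N = "{u. (v, u) \<in> parcs G}"
  have N: "?N \<subseteq> pverts G" using in_arcsD2 by auto
  have fin: "finite ?C" "finite ?N"
    using pair_finite_verts finite_subset[OF N pair_finite_verts] by auto
  have "?C \<inter> ?N = {}" using proper_colorings_neq[OF c] by force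
  then have card: "card (?C \<union> ?N) = card ?C + r"
    using card_Un_disjoint[OF fin] regular_degree[OF assms(2) v] by simp
  show "card ?C + r \<le> card (pverts G)"
    using card_mono[OF pair_finite_verts, of "?C \<union> ?N"] N card by auto
  show "\<forall>w\<in>pverts G. c w \<noteq> c v \<longrightarrow> (v, w) \<in> parcs G" if "card ?C + r = card (pverts G)"
    using card_subset_eq[OF pair_finite_verts, of "?C \<union> ?N"] N card that by auto
qed

lemma card_eq_sum_color_classes:
  assumes "finite V" "\<And>v. v \<in> V \<Longrightarrow> c v < (k :: nat)"
  shows "card V = (\<Sum>j<k. card {v\<in>V. c v = j})"
proof -
  have "V = (\<Union>j<k. {v\<in>V. c v = j})" using assms by auto
  then have "card V = card (\<Union>j<k. {v\<in>V. c v = j})" by simp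
  also have "\<dots> = (\<Sum>j<k. card {v\<in>V. c v = j})"
    using assms(1) by (intro card_UN_disjoint) auto
  finally show ?thesis .
qed

text \<open>The last claim holds because color classes of size at most 3 with total
  \<open>3 * k - 1\<close> are all triples except for one pair. Vertices of triples are joined to
  everything outside their class, so a vertex of the pair would have degree \<open>n - 2\<close>
  instead of \<open>n - 3\<close>.\<close>

lemma regular_graphs_bounds:
  assumes G: "G \<in> regular_graphs n r k" and k: "k > 0"
  shows "r < n" "n \<le> k * (n - r)" "even (n * r)" "\<not> (n = 3 * k - 1 \<and> n = r + 3)"
proof -
  have PG: "pair_graph G" and n: "card (pverts G) = n" and reg: "regular G r"
    and chi: "chromatic_number G = k" using G by (auto simp: regular_graphs_def)
  interpret pair_graph G by fact
  obtain c where c: "c \<in> proper_colorings G k"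
    using proper_colorings_chromatic_number[OF PG] chi by auto
  let ?C = "\<lambda>j. {v\<in>pverts G. c v = j}"
  have le: "card (?C j) + r \<le> n" if "j < k" for j
    using proper_colorings_surj[OF PG] c chi that color_class_card(1)[OF PG reg c] n by auto
  have sum: "n = (\<Sum>j<k. card (?C j))"
    using card_eq_sum_color_classes[of "pverts G" c k] proper_colorings_lt[OF c] n pair_finite_verts
    by auto
  show "even (n * r)" using regular_handshake[OF PG reg] n by simp
  obtain v where v: "v \<in> pverts G" using proper_colorings_surj[OF PG] c chi k by blast
  have "0 < card (?C (c v))" using v pair_finite_verts by (auto simp: card_gt_0_iff)
  then show "r < n" using le[OF proper_colorings_lt[OF c v]] by simp
  have "(\<Sum>j<k. card (?C j)) \<le> (\<Sum>j<k. n - r)" using le by (intro sum_mono) fastforce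
  then show "n \<le> k * (n - r)" using sum by simp
  show "\<not> (n = 3 * k - 1 \<and> n = r + 3)"
  proof
    assume A: "n = 3 * k - 1 \<and> n = r + 3"
    have le3: "card (?C j) \<le> 3" if "j < k" for j using le[OF that] A by simp
    have "\<exists>a<k. card (?C a) < 3"
    proof (rule ccontr)
      assume "\<not> ?thesis"
      then have "(\<Sum>j<k. card (?C j)) = (\<Sum>j<k. 3)" using le3 by (intro sum.cong) fastforce+
      then show False using sum A k by simp
    qed
    then obtain a where a: "a < k" "card (?C a) < 3" by blast
    have sum_a: "n = card (?C a) + (\<Sum>j\<in>{..<k} - {a}. card (?C j))"
      using sum a by (simp add: sum.remove[of "{..<k}" a])
    have others: "card (?C b) = 3" if "b < k" "b \<noteq> a" for b
    proof (rule ccontr)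
      assume "card (?C b) \<noteq> 3"
      then have "card (?C b) < 3" using le3[OF that(1)] by simp
      then have "(\<Sum>j\<in>{..<k} - {a}. card (?C j)) < (\<Sum>j\<in>{..<k} - {a}. 3)"
        using that le3 by (intro sum_strict_mono_ex1) auto
      also have "\<dots> = 3 * (k - 1)" using a by simp
      finally show False using sum_a a A by simp
    qed
    have "(\<Sum>j\<in>{..<k} - {a}. card (?C j)) = (\<Sum>j\<in>{..<k} - {a}. 3)"
      using others by (intro sum.cong) auto
    also have "\<dots> = 3 * (k - 1)" using a by simp
    finally have ca: "card (?C a) = 2" using sum_a A k by simp
    then have "?C a \<noteq> {}" by (metis card.empty zero_neq_numeral)
    then obtain x where x: "x \<in> pverts G" "c x = a" by auto
    have "pverts G - ?C a \<subseteq> {u. (x, u) \<in> parcs G}"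
    proof
      fix w assume w: "w \<in> pverts G - ?C a"
      then have "card (?C (c w)) = 3" using others proper_colorings_lt[OF c] by auto
      then have "(w, x) \<in> parcs G"
        using color_class_card(2)[OF PG reg c, of w] w x n A by auto
      then show "w \<in> {u. (x, u) \<in> parcs G}"
        using pair_sym_arcs by (auto simp: symmetric_def dest: symD)
    qed
    moreover have "finite {u. (x, u) \<in> parcs G}"
      using finite_subset[OF _ pair_finite_verts] in_arcsD2 by (metis mem_Collect_eq subsetI)
    ultimately have "card (pverts G - ?C a) \<le> card {u. (x, u) \<in> parcs G}" by (rule card_mono[rotated])
    moreover have "card (pverts G - ?C a) = n - 2"
      using card_Diff_subset[of "?C a" "pverts G"] pair_finite_verts ca n by auto
    ultimately have "n - 2 \<le> r" using regular_degree[OF reg x(1)] by simp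
    then show False using A by linarith
  qed
qed

section \<open>Choice of the construction by parameters\<close>

theorem theorem1:
  fixes n r k :: nat
  assumes "k > 0"
    and "n < 3 * k"
    and "r \<ge> 2 * (k - 1)"
    and "regular_graphs n r k \<noteq> {}"
  shows "min_defining_number n r k = k - 1"
proof -
  obtain G0 where "G0 \<in> regular_graphs n r k" using assms(4) by blast
  note bounds = regular_graphs_bounds[OF this assms(1)]
  have "\<exists>G\<in>regular_graphs n r k. defining_number G \<le> k - 1"
  proof -
    \<comment> \<open>\<open>s\<close> is the complement degree plus one, and it bounds the size of
      every color class.\<close>
    define s where "s = n - r"
    have ns: "n = r + s" and nks: "n \<le> k * s" using bounds by (auto simp: s_def)
    consider "s = 1" | "s = 2" | "s \<ge> 3" using bounds(1) by (fastforce simp: s_def)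
    then show ?thesis
    proof cases
      case 1
      then have "k = 1" "n = 1" "r = 0" using ns nks assms by auto
      then show ?thesis using cliques_plus_circulant[of 1 0 0 0] by simp
    next
      case 2
      \<comment> \<open>Both \<open>n = r + 2 \<ge> 2 * k\<close> and \<open>n \<le> 2 * k\<close>
        hold; the complement is a perfect matching.\<close>
      then have "n = 2 * k" using ns nks assms by auto
      then show ?thesis using cliques_plus_circulant[of k 0 1 r] 2 ns assms(1) by (simp add: mult_2)
    next
      case 3
      define t p e where "t = n - 2 * k" and "p = 3 * k - n" and "e = s - 3"
      have n: "n = 3 * t + 2 * p" and k: "k = t + p" and re: "n = r + e + 3"
        and et: "e < t" and p: "p > 0"
        using 3 ns assms by (auto simp: t_def p_def e_def)
      show ?thesis
      proof (cases "e = 0")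
        case True
        \<comment> \<open>With \<open>p = 1\<close> one would have \<open>n = 3 * k - 1\<close> and
          \<open>n = r + 3\<close>. For \<open>p \<ge> 2\<close> the complement consists of
          \<open>t\<close> triangles and a bipartite circulant of degree 2.\<close>
        then have "p \<noteq> 1" using bounds(4) n k re by auto
        then show ?thesis
          using cliques_plus_circulant[of t p 2 r] True n k re et p by (simp add: mult.commute)
      next
        case False
        \<comment> \<open>The circulant needs this parity. For odd \<open>t\<close> also
          \<open>n\<close> is odd, so \<open>r\<close> and hence \<open>n - r - 3\<close> are
          even.\<close>
        have "even (t * e)"
        proof (cases "even t")
          case False
          then have "odd n" using n by simp
          then have "even r" using bounds(3) by simp
          then show ?thesis using re \<open>odd n\<close> by auto
        qed simp
        show ?thesis
        proof (cases "e = 1 \<and> t = 2 \<and> p \<ge> 2")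
          case True
          \<comment> \<open>A 4-clique and a bipartite circulant of degree 3 on \<open>p + 1\<close>
            color pairs need \<open>p + 1 \<ge> 4\<close>, which leaves \<open>p = 2\<close> to the
            sporadic graph.\<close>
          show ?thesis
          proof (cases "p = 2")
            case p2: True
            then show ?thesis using sporadic_10_6_4 True n k re by simp
          next
            case False
            have "n = 1 * (3 + 1) + 2 * (p + 1)" "k = 1 + (p + 1)" using True n k by auto
            then show ?thesis
              using cliques_plus_circulant[of 1 "p + 1" 3 r] False True re by simp
          qed
        next
          case nsp: False
          \<comment> \<open>For \<open>e = 1\<close> the only level is 0, so \<open>u0 = 2\<close>
            is needed and hence \<open>t > 2\<close> unless \<open>p \<le> 1\<close>. For
            \<open>e \<ge> 2\<close> level 1 exists and \<open>u0 = e\<close> suffices.\<close>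
          have "\<exists>l0 u0. p \<le> e \<or> l0 < e \<and> u0 < t \<and> e < l0 + u0"
          proof (cases "e = 1")
            case True
            then have "p \<le> e \<or> 2 < t" using nsp et by auto
            then show ?thesis using True by (intro exI[of _ 0] exI[of _ 2]) auto
          next
            case e2: False
            then show ?thesis using False et by (intro exI[of _ 1] exI[of _ e]) auto
          qed
          then obtain l0 u0 where "p \<le> e \<or> l0 < e \<and> u0 < t \<and> e < l0 + u0" by blast
          then show ?thesis
            using triples_and_pairs_circulant[of e t p r l0 u0] False et \<open>even (t * e)\<close> n k re by simp
        qed
      qed
    qed
  qed
  then show ?thesis using min_defining_number_eqI by blast
qed

end
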